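(* (a) Let $(Q,+)$ be a commutative RIF loop of exponent $6$, with neutral element $0$, and define $x\cdot y=(-x)+(-y)$ for $x,y\in Q$. Then $(Q,\cdot)$ is a totally symmetric quasigroup satisfying, for all $x,y,z\in Q$, $$\text{(Q1)}\quad x^2\cdot x^2=x^2,\qquad \text{(Q2)}\quad x\cdot(y^2\cdot(x\cdot z))=(x\cdot y)^2\cdot z .$$ (b) Conversely, let $(Q,\cdot)$ be a totally symmetric quasigroup satisfying (Q1) and (Q2), let $0\in Q$ be an idempotent, and define $x+y=(0\cdot x)\cdot(0\cdot y)$ for $x,y\in Q$. Then $(Q,+)$ is a commutative RIF loop of exponent $6$.
   Context: A quasigroup is a set $Q$ with a binary operation such that for all $a,b\in Q$ the equations $ax=b$ and $ya=b$ have unique solutions $x,y\in Q$; a loop is a quasigroup with a neutral element. In quasigroups, $x^2=x\cdot x$. A quasigroup is totally symmetric if it is commutative and satisfies $x\cdot(x\cdot y)=y$. An element $0$ is idempotent if $0\cdot 0=0$. In additive notation for a loop, $-x$ is the inverse of $x$. A loop is an inverse property (IP) loop if each $x$ has a (two-sided) inverse $-x$ with $(-x)+(x+y)=y$ and $(y+x)+(-x)=y$ for all $y$. A RIF loop is an IP loop satisfying either, and hence both, of the (equivalent) identities, written multiplicatively, $((xy)z)(xy)=x(y((zx)y))$ and $(xy)(z(xy))=((x(yz))x)y$. It is known that RIF loops are diassociative (any two elements generate a subgroup), so multiples $nx$ are well defined. A loop $(Q,+)$ has exponent $n$ if $nx=0$ for all $x$. *)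

theory Defs
  imports Main
begin

text \<open>
  Quasigroups and loops live on an explicit carrier \<open>Q\<close>; the values of the operation outside
  \<open>Q\<close> are irrelevant.
\<close>

locale quasigroup =
  fixes Q :: "'a set" and mult :: "'a \<Rightarrow> 'a \<Rightarrow> 'a" (infixl "\<odot>" 70)
  assumes closed: "a \<in> Q \<Longrightarrow> b \<in> Q \<Longrightarrow> a \<odot> b \<in> Q"
    and left_div: "a \<in> Q \<Longrightarrow> b \<in> Q \<Longrightarrow> \<exists>!x. x \<in> Q \<and> a \<odot> x = b"
    and right_div: "a \<in> Q \<Longrightarrow> b \<in> Q \<Longrightarrow> \<exists>!y. y \<in> Q \<and> y \<odot> a = b"
begin

definition square :: "'a \<Rightarrow> 'a" where
  "square x = x \<odot> x"

definition Q1 :: bool where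
  "Q1 \<longleftrightarrow> (\<forall>x\<in>Q. square x \<odot> square x = square x)"

definition Q2 :: bool where
  "Q2 \<longleftrightarrow> (\<forall>x\<in>Q. \<forall>y\<in>Q. \<forall>z\<in>Q. x \<odot> (square y \<odot> (x \<odot> z)) = square (x \<odot> y) \<odot> z)"

end

locale totally_symmetric_quasigroup = quasigroup +
  assumes commute: "x \<in> Q \<Longrightarrow> y \<in> Q \<Longrightarrow> x \<odot> y = y \<odot> x"
    and mult_mult_cancel: "x \<in> Q \<Longrightarrow> y \<in> Q \<Longrightarrow> x \<odot> (x \<odot> y) = y"

locale loop = quasigroup Q add
  for Q :: "'a set" and add :: "'a \<Rightarrow> 'a \<Rightarrow> 'a" (infixl "\<oplus>" 65) +
  fixes zero :: 'a ("\<zero>")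
  assumes zero_closed: "\<zero> \<in> Q"
    and zero_left: "x \<in> Q \<Longrightarrow> \<zero> \<oplus> x = x"
    and zero_right: "x \<in> Q \<Longrightarrow> x \<oplus> \<zero> = x"
begin

definition neg :: "'a \<Rightarrow> 'a" where
  "neg x = (THE y. y \<in> Q \<and> x \<oplus> y = \<zero> \<and> y \<oplus> x = \<zero>)"

text \<open>
  In a general loop multiples depend on the bracketing; here they are right-nested,
  \<open>n x = x \<oplus> (x \<oplus> (\<dots> \<oplus> \<zero>))\<close>.  In RIF loops, which are diassociative, the choice is immaterial.
\<close>

definition multiple :: "nat \<Rightarrow> 'a \<Rightarrow> 'a" where
  "multiple n x = ((\<lambda>y. x \<oplus> y) ^^ n) \<zero>"

definition has_exponent :: "nat \<Rightarrow> bool" where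
  "has_exponent n \<longleftrightarrow> (\<forall>x\<in>Q. multiple n x = \<zero>)"

end

locale IP_loop = loop +
  assumes inverse_property:
    "x \<in> Q \<Longrightarrow> \<exists>x'\<in>Q. x \<oplus> x' = \<zero> \<and> x' \<oplus> x = \<zero> \<and>
       (\<forall>y\<in>Q. x' \<oplus> (x \<oplus> y) = y \<and> (y \<oplus> x) \<oplus> x' = y)"
begin

lemma neg_eq:
  assumes "x \<in> Q" "x' \<in> Q" "x \<oplus> x' = \<zero>" "x' \<oplus> x = \<zero>"
  shows "neg x = x'"
  unfolding neg_def
proof (rule the_equality)
  show "x' \<in> Q \<and> x \<oplus> x' = \<zero> \<and> x' \<oplus> x = \<zero>" using assms by blast
next
  fix y assume "y \<in> Q \<and> x \<oplus> y = \<zero> \<and> y \<oplus> x = \<zero>"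
  then show "y = x'" using left_div[OF assms(1) zero_closed] assms by blast
qed

lemma neg_props:
  assumes "x \<in> Q"
  shows neg_closed: "neg x \<in> Q" and neg_right: "x \<oplus> neg x = \<zero>" and neg_left: "neg x \<oplus> x = \<zero>"
    and neg_add_cancel: "y \<in> Q \<Longrightarrow> neg x \<oplus> (x \<oplus> y) = y"
    and add_neg_cancel: "y \<in> Q \<Longrightarrow> (y \<oplus> x) \<oplus> neg x = y"
proof -
  obtain x' where x': "x' \<in> Q" "x \<oplus> x' = \<zero>" "x' \<oplus> x = \<zero>"
      "\<forall>y\<in>Q. x' \<oplus> (x \<oplus> y) = y \<and> (y \<oplus> x) \<oplus> x' = y"
    using inverse_property[OF assms] by blast
  moreover have "neg x = x'" using neg_eq assms x' by blast
  ultimately show "neg x \<in> Q" "x \<oplus> neg x = \<zero>" "neg x \<oplus> x = \<zero>"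
    "y \<in> Q \<Longrightarrow> neg x \<oplus> (x \<oplus> y) = y" "y \<in> Q \<Longrightarrow> (y \<oplus> x) \<oplus> neg x = y"
    by auto
qed

lemma neg_neg: "x \<in> Q \<Longrightarrow> neg (neg x) = x"
  by (rule neg_eq) (simp_all add: neg_props)

lemma neg_add:
  assumes "x \<in> Q" "y \<in> Q"
  shows "neg (x \<oplus> y) = neg y \<oplus> neg x"
proof -
  have c: "x \<oplus> y \<in> Q" "neg x \<in> Q" "neg y \<in> Q" "neg (x \<oplus> y) \<in> Q"
    using assms closed neg_closed by blast+
  have "x \<oplus> y \<oplus> neg y = x" using assms by (simp add: add_neg_cancel)
  then have "neg (x \<oplus> y) \<oplus> x = neg y"
    using neg_add_cancel[OF c(1) c(3)] by simp
  then show ?thesis using add_neg_cancel[OF assms(1) c(4)] by simp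
qed

definition RIF1 :: bool where
  "RIF1 \<longleftrightarrow> (\<forall>x\<in>Q. \<forall>y\<in>Q. \<forall>z\<in>Q.
     ((x \<oplus> y) \<oplus> z) \<oplus> (x \<oplus> y) = x \<oplus> (y \<oplus> ((z \<oplus> x) \<oplus> y)))"

definition RIF2 :: bool where
  "RIF2 \<longleftrightarrow> (\<forall>x\<in>Q. \<forall>y\<in>Q. \<forall>z\<in>Q.
     (x \<oplus> y) \<oplus> (z \<oplus> (x \<oplus> y)) = ((x \<oplus> (y \<oplus> z)) \<oplus> x) \<oplus> y)"

text \<open>Inversion is an anti-automorphism, and it interchanges the two identities.\<close>

lemma RIF1_iff_RIF2: "RIF1 \<longleftrightarrow> RIF2"
proof
  assume R: RIF1
  show RIF2 unfolding RIF2_def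
  proof (intro ballI)
    fix x y z assume Q: "x \<in> Q" "y \<in> Q" "z \<in> Q"
    have "((neg y \<oplus> neg x) \<oplus> neg z) \<oplus> (neg y \<oplus> neg x)
        = neg y \<oplus> (neg x \<oplus> ((neg z \<oplus> neg y) \<oplus> neg x))"
      using R Q unfolding RIF1_def by (simp add: neg_closed)
    from arg_cong[OF this, of neg]
    show "(x \<oplus> y) \<oplus> (z \<oplus> (x \<oplus> y)) = ((x \<oplus> (y \<oplus> z)) \<oplus> x) \<oplus> y"
      using Q by (simp add: neg_add neg_neg neg_closed closed)
  qed
next
  assume R: RIF2
  show RIF1 unfolding RIF1_def
  proof (intro ballI)
    fix x y z assume Q: "x \<in> Q" "y \<in> Q" "z \<in> Q"
    have "(neg y \<oplus> neg x) \<oplus> (neg z \<oplus> (neg y \<oplus> neg x))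
        = ((neg y \<oplus> (neg x \<oplus> neg z)) \<oplus> neg y) \<oplus> neg x"
      using R Q unfolding RIF2_def by (simp add: neg_closed)
    from arg_cong[OF this, of neg]
    show "((x \<oplus> y) \<oplus> z) \<oplus> (x \<oplus> y) = x \<oplus> (y \<oplus> ((z \<oplus> x) \<oplus> y))"
      using Q by (simp add: neg_add neg_neg neg_closed closed)
  qed
qed

end

locale RIF_loop = IP_loop +
  assumes RIF: "RIF1 \<or> RIF2"

locale commutative_RIF_loop = RIF_loop +
  assumes add_commute: "x \<in> Q \<Longrightarrow> y \<in> Q \<Longrightarrow> x \<oplus> y = y \<oplus> x"

end

theory Submission
  imports Defs
begin

text \<open>
  Write \<open>L\<^sub>x\<close> for translation by \<open>x\<close>.  In a commutative RIF loop the RIF identity reads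
  \<open>L\<^sub>x\<^sub>+\<^sub>y\<^sup>2 = L\<^sub>y L\<^sub>x\<^sup>2 L\<^sub>y\<close>; evaluating it at \<open>0\<close> with \<open>x - y\<close> in place of \<open>x\<close> gives the
  alternative law \<open>L\<^sub>x\<^sup>2 = L\<^sub>2\<^sub>x\<close>, which turns the RIF identity into (Q2) and
  \<open>6x = 0\<close> into (Q1).

  Conversely, the crux is that translation by an idempotent \<open>0\<close> is an automorphism of the
  quasigroup.  It respects products with a square factor by (Q2), and products with a factor \<open>u\<close>
  such that \<open>u\<^sup>2 = 0\<close>, because its translation then commutes with \<open>L\<^sub>0\<close>.  Every element is a product
  \<open>x = 0x\<^sup>2 \<cdot> u\<close> of these two kinds (the splitting \<open>x = -2x + 3x\<close>), and (Q2) expresses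
  \<open>z \<cdot> (0x\<^sup>2 \<cdot> u)\<close> as \<open>(z \<cdot> 0x\<^sup>2)\<^sup>2 \<cdot> (z \<cdot> u)\<close>.  Hence \<open>x + y = 0 \<cdot> xy\<close>, and (Q2) becomes the
  RIF identity.
\<close>

section \<open>From commutative RIF loops of exponent 6 to quasigroups\<close>

context commutative_RIF_loop
begin

lemma RIF_translation:
  assumes "x \<in> Q" "y \<in> Q" "z \<in> Q"
  shows "(x \<oplus> y) \<oplus> ((x \<oplus> y) \<oplus> z) = y \<oplus> (x \<oplus> (x \<oplus> (y \<oplus> z)))"
proof -
  have "(x \<oplus> y) \<oplus> (z \<oplus> (x \<oplus> y)) = ((x \<oplus> (y \<oplus> z)) \<oplus> x) \<oplus> y"
    using RIF RIF1_iff_RIF2 assms unfolding RIF2_def by blast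
  then show ?thesis using assms by (metis add_commute closed)
qed

lemma alternative:
  assumes "x \<in> Q" "y \<in> Q"
  shows "x \<oplus> (x \<oplus> y) = (x \<oplus> x) \<oplus> y"
proof -
  define v where "v = x \<oplus> y"
  have v: "v \<in> Q" "v \<oplus> neg y = x" using assms by (simp_all add: v_def closed add_neg_cancel)
  have "x \<oplus> x = neg y \<oplus> (v \<oplus> x)"
    \<comment> \<open>Since \<open>v\<close> minus \<open>y\<close> is \<open>x\<close>, the left
      side of this instance collapses to the double of \<open>x\<close>.\<close>
    using RIF_translation[of v "neg y" \<zero>] v assms by (simp add: zero_right zero_closed neg_closed)
  then have "y \<oplus> (x \<oplus> x) = v \<oplus> x"
    using neg_add_cancel[of "neg y" "v \<oplus> x"] v(1) assms by (simp add: neg_neg neg_closed closed)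
  then show ?thesis using v(1) assms by (simp add: add_commute closed flip: v_def)
qed

lemma TS_quasigroup_neg_add:
  assumes mult: "\<And>x y. x \<in> Q \<Longrightarrow> y \<in> Q \<Longrightarrow> mult x y = neg x \<oplus> neg y"
  shows "totally_symmetric_quasigroup Q mult"
proof -
  have cl: "mult x y \<in> Q" and com: "mult x y = mult y x" if "x \<in> Q" "y \<in> Q" for x y
    using that by (simp_all add: mult closed neg_closed add_commute)
  have canc: "mult x (mult x y) = y" if "x \<in> Q" "y \<in> Q" for x y
  proof -
    have "mult x y = neg (x \<oplus> y)" using that by (simp add: mult neg_add add_commute neg_closed)
    then have "mult x (mult x y) = neg x \<oplus> (x \<oplus> y)"
      using that cl by (simp add: mult[of x "neg (x \<oplus> y)"] neg_neg closed neg_closed)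
    then show ?thesis using that by (simp add: neg_add_cancel)
  qed
  show ?thesis
  proof unfold_locales
    fix a b assume ab: "a \<in> Q" "b \<in> Q"
    \<comment> \<open>By \<open>canc\<close> and commutativity, both equations are solved exactly by
      \<open>mult a b\<close>.\<close>
    show "\<exists>!x. x \<in> Q \<and> mult a x = b" using ab canc cl by metis
    show "\<exists>!y. y \<in> Q \<and> mult y a = b" using ab canc cl com by metis
  qed (use cl com canc in auto)
qed

lemma Q1_Q2_neg_add:
  assumes mult: "\<And>x y. x \<in> Q \<Longrightarrow> y \<in> Q \<Longrightarrow> mult x y = neg x \<oplus> neg y"
    and exp: "has_exponent 6"
  shows "quasigroup.Q1 Q mult" "quasigroup.Q2 Q mult"
proof -
  interpret T: totally_symmetric_quasigroup Q mult by (rule TS_quasigroup_neg_add[OF mult])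
  have mn: "mult x y = neg (x \<oplus> y)" if "x \<in> Q" "y \<in> Q" for x y
    using that by (simp add: mult neg_add add_commute neg_closed)
  note cls = closed neg_closed
  show "T.Q1" unfolding T.Q1_def T.square_def
  proof
    fix x assume x: "x \<in> Q"
    \<comment> \<open>The square of \<open>x\<close> is \<open>neg d\<close>, and the square of
      \<open>neg d\<close> is \<open>d \<oplus> d\<close>; so (Q1) at \<open>x\<close> says 3d = 0,
      that is, 6x = 0.\<close>
    define d where "d = x \<oplus> x"
    have d: "d \<in> Q" using x closed by (simp add: d_def)
    have "multiple 6 x = x \<oplus> (x \<oplus> (x \<oplus> (x \<oplus> d)))"
      unfolding multiple_def d_def using x by (simp add: numeral_eq_Suc zero_right)
    also have "\<dots> = d \<oplus> (d \<oplus> d)" using x d closed by (simp add: alternative flip: d_def)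
    finally have "d \<oplus> (d \<oplus> d) = \<zero>" using exp x by (simp add: has_exponent_def)
    then have "neg d = d \<oplus> d" using d by (intro neg_eq) (simp_all add: closed add_commute)
    moreover have "mult (neg d) (neg d) = d \<oplus> d"
      using d by (simp add: mult neg_closed neg_neg)
    ultimately show "mult (mult x x) (mult x x) = mult x x" using x by (simp add: mn flip: d_def)
  qed
  show "T.Q2" unfolding T.Q2_def T.square_def
  proof (intro ballI)
    fix x y z assume Q: "x \<in> Q" "y \<in> Q" "z \<in> Q"
    have "mult x (mult (mult y y) (mult x z)) = neg x \<oplus> neg (mult (mult y y) (mult x z))"
      using Q by (intro mult) (simp_all add: T.closed)
    also have "neg (mult (mult y y) (mult x z)) = neg ((y \<oplus> y) \<oplus> (x \<oplus> z))"
      using Q by (simp add: mn[of y y] mn[of x z] mult[of "neg _" "neg _"] neg_neg cls)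
    also have "neg x \<oplus> \<dots> = neg (x \<oplus> ((y \<oplus> y) \<oplus> (x \<oplus> z)))"
      using Q by (simp add: neg_add[of x] add_commute cls)
    \<comment> \<open>The only use of the RIF identity: the alternative law splits the double of
      \<open>y\<close> into two translations by \<open>y\<close>.\<close>
    also have "x \<oplus> ((y \<oplus> y) \<oplus> (x \<oplus> z)) = (x \<oplus> y) \<oplus> ((x \<oplus> y) \<oplus> z)"
      using RIF_translation[of y x z] Q by (simp add: alternative[of y] closed add_commute[of y x])
    also have "\<dots> = ((x \<oplus> y) \<oplus> (x \<oplus> y)) \<oplus> z" using Q by (simp add: alternative closed)
    also have "neg \<dots> = mult ((x \<oplus> y) \<oplus> (x \<oplus> y)) z" using Q by (simp add: mn closed)
    also have "(x \<oplus> y) \<oplus> (x \<oplus> y) = mult (mult x y) (mult x y)"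
      using Q by (simp add: mn[of x y] mult[of "neg _" "neg _"] neg_neg cls)
    finally show "mult x (mult (mult y y) (mult x z)) = mult (mult (mult x y) (mult x y)) z" .
  qed
qed

end

section \<open>Translation by an idempotent \<open>e\<close> (the 0 above) is an
  automorphism\<close>

locale pointed_Q12_quasigroup = totally_symmetric_quasigroup +
  fixes e
  assumes Q1: Q1 and Q2: Q2 and e_closed: "e \<in> Q" and e_idem: "e \<odot> e = e"
begin

lemma square_closed: "x \<in> Q \<Longrightarrow> square x \<in> Q"
  by (simp add: square_def closed)

lemmas cl = closed square_closed e_closed

lemma square_e: "square e = e"
  by (simp add: square_def e_idem)

lemma square_square: "x \<in> Q \<Longrightarrow> square (square x) = square x"
  using Q1 by (simp add: Q1_def square_def)

lemma Q2_eq: "x \<in> Q \<Longrightarrow> y \<in> Q \<Longrightarrow> z \<in> Q \<Longrightarrow> x \<odot> (square y \<odot> (x \<odot> z)) = square (x \<odot> y) \<odot> z"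
  using Q2 by (simp add: Q2_def)

text \<open>(Q2) with \<open>x \<odot> w\<close> for \<open>z\<close>, since
  \<open>x \<odot> (x \<odot> w) = w\<close>; in this form it distributes \<open>x\<close> over a
  product with a square factor.\<close>

lemma mult_square_mult:
  assumes "x \<in> Q" "y \<in> Q" "w \<in> Q"
  shows "x \<odot> (square y \<odot> w) = square (x \<odot> y) \<odot> (x \<odot> w)"
  using Q2_eq[of x y "x \<odot> w"] assms by (simp add: mult_mult_cancel cl)

text \<open>The left side of (Q2) involves \<open>y\<close> only through its square, which (Q1)
  leaves unchanged when \<open>y\<close> is replaced by \<open>square y\<close>.\<close>

lemma square_mult_square:
  assumes "x \<in> Q" "y \<in> Q"
  shows "square (x \<odot> square y) = square (x \<odot> y)"
proof -
  have "square (x \<odot> square y) \<odot> x = square (x \<odot> y) \<odot> x"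
    using Q2_eq[of x "square y" x] Q2_eq[of x y x] assms by (simp add: square_square cl)
  then show ?thesis using assms by (metis cl(1,2) commute mult_mult_cancel)
qed

lemma e_mult_square:
  assumes "y \<in> Q"
  shows "e \<odot> square y = square (e \<odot> y)"
proof -
  have "square y = e \<odot> square (e \<odot> y)"
    using Q2_eq[of e y e] assms by (simp add: e_idem commute[of _ e] mult_mult_cancel cl)
  then show ?thesis using assms by (metis cl mult_mult_cancel)
qed

lemma e_mult_square_mult:
  assumes "y \<in> Q" "w \<in> Q"
  shows "e \<odot> (square y \<odot> w) = (e \<odot> square y) \<odot> (e \<odot> w)"
  using mult_square_mult[of e y w] assms by (simp add: e_mult_square cl)

text \<open>Here \<open>u \<odot> e = u\<close>, so (Q2) with \<open>e\<close> for \<open>y\<close>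
  makes the translations by \<open>u\<close> and \<open>e\<close> commute.\<close>

lemma e_mult_involution_mult:
  assumes "u \<in> Q" "z \<in> Q" and u: "square u = e"
  shows "e \<odot> (u \<odot> z) = (e \<odot> u) \<odot> (e \<odot> z)"
proof -
  have ue: "u \<odot> e = u" using mult_mult_cancel[of u u] u assms(1) by (simp add: square_def)
  then have "u \<odot> (e \<odot> (u \<odot> z)) = e \<odot> z"
    using Q2_eq[of u e z] assms by (simp add: square_e cl)
  then have "e \<odot> (u \<odot> z) = u \<odot> (e \<odot> z)" using assms by (metis cl mult_mult_cancel)
  then show ?thesis using ue assms(1) by (simp add: commute cl)
qed

lemma e_mult_mult:
  assumes "x \<in> Q" "z \<in> Q"
  shows "e \<odot> (z \<odot> x) = (e \<odot> z) \<odot> (e \<odot> x)"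
proof -
  \<comment> \<open>In the loop to be built, \<open>s\<close> is 2x and \<open>u\<close> is -3x, so
    \<open>s \<odot> u\<close> is -2x + 3x.\<close>
  define s where "s = e \<odot> square x"
  define u where "u = s \<odot> x"
  have s: "s \<in> Q" "square s = s" "s = square (e \<odot> x)"
    using assms by (simp_all add: s_def e_mult_square square_square cl)
  have u: "u \<in> Q" "s \<odot> u = x" using assms s by (simp_all add: u_def mult_mult_cancel cl)
  \<comment> \<open>Under the outer square, the factor \<open>s\<close> may be replaced by
    \<open>e \<odot> x\<close>, whose square it is.\<close>
  have "square u = square (x \<odot> (e \<odot> x))"
    using square_mult_square[of x "e \<odot> x"] assms s by (simp add: u_def commute cl)
  also have "x \<odot> (e \<odot> x) = e" using assms by (simp add: commute[of e x] mult_mult_cancel cl)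
  finally have sq: "square u = e" by (simp add: square_e)
  have esq: "square (e \<odot> s) = e \<odot> s" using e_mult_square[of s] s by simp
  have "e \<odot> (z \<odot> x) = e \<odot> (square (z \<odot> s) \<odot> (z \<odot> u))"
    using mult_square_mult[of z s u] assms s u by simp
  also have "\<dots> = (e \<odot> square (z \<odot> s)) \<odot> (e \<odot> (z \<odot> u))"
    using assms s u by (simp add: e_mult_square_mult cl)
  also have "e \<odot> square (z \<odot> s) = square ((e \<odot> z) \<odot> (e \<odot> s))"
  proof -
    have "e \<odot> (z \<odot> s) = (e \<odot> z) \<odot> (e \<odot> s)"
      using e_mult_square_mult[of s z] assms s(1,2) by (simp add: commute cl)
    then show ?thesis using assms s(1) by (simp add: e_mult_square cl)
  qed
  also have "e \<odot> (z \<odot> u) = (e \<odot> z) \<odot> (e \<odot> u)"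
    using e_mult_involution_mult[OF u(1) assms(2) sq] assms u by (simp add: commute cl)
  \<comment> \<open>The first rewriting read backwards; it applies because
    \<open>e \<odot> s\<close> is again its own square.\<close>
  also have "square ((e \<odot> z) \<odot> (e \<odot> s)) \<odot> ((e \<odot> z) \<odot> (e \<odot> u)) = (e \<odot> z) \<odot> ((e \<odot> s) \<odot> (e \<odot> u))"
    using mult_square_mult[of "e \<odot> z" "e \<odot> s" "e \<odot> u"] assms s u esq by (simp add: cl)
  also have "(e \<odot> s) \<odot> (e \<odot> u) = e \<odot> x"
    using e_mult_square_mult[of s u] s u by simp
  finally show ?thesis .
qed

section \<open>The loop obtained from the quasigroup\<close>

context
  fixes add
  assumes add: "\<And>x y. x \<in> Q \<Longrightarrow> y \<in> Q \<Longrightarrow> add x y = (e \<odot> x) \<odot> (e \<odot> y)"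
begin

lemma add_eq: "x \<in> Q \<Longrightarrow> y \<in> Q \<Longrightarrow> add x y = e \<odot> (x \<odot> y)"
  by (simp add: add e_mult_mult)

lemma add_closed: "x \<in> Q \<Longrightarrow> y \<in> Q \<Longrightarrow> add x y \<in> Q"
  by (simp add: add_eq cl)

lemma add_com: "x \<in> Q \<Longrightarrow> y \<in> Q \<Longrightarrow> add x y = add y x"
  by (simp add: add_eq commute)

lemma add_e: "x \<in> Q \<Longrightarrow> add e x = x"
  by (simp add: add_eq mult_mult_cancel cl)

text \<open>The negative of \<open>x\<close> is \<open>e \<odot> x\<close>: by the automorphism the
  sum is \<open>e \<odot> (e \<odot> (x \<odot> (x \<odot> y)))\<close>.\<close>

lemma neg_add_eq:
  assumes "x \<in> Q" "y \<in> Q"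
  shows "add (e \<odot> x) (add x y) = y"
  using assms by (simp add: add_eq cl flip: e_mult_mult) (simp add: mult_mult_cancel cl)

text \<open>The alternative law is (Q2) with \<open>e\<close> for \<open>y\<close>, translated by
  \<open>e\<close>.\<close>

lemma add_add:
  assumes "x \<in> Q" "z \<in> Q"
  shows "add x (add x z) = add (add x x) z"
proof -
  have "x \<odot> (e \<odot> (x \<odot> z)) = square (e \<odot> x) \<odot> z"
    using Q2_eq[of x e z] assms by (simp add: square_e commute[of x e] cl)
  moreover have "add x x = square (e \<odot> x)" using assms by (simp add: add square_def)
  ultimately show ?thesis using assms by (simp add: add_eq[of _ "_ \<odot> _"] add_eq[of _ z] cl)
qed

lemma add_RIF:
  assumes "x \<in> Q" "y \<in> Q" "z \<in> Q"
  shows "add (add x y) (add z (add x y)) = add (add (add x (add y z)) x) y"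
proof -
  have dbl: "add w w = e \<odot> square w" if "w \<in> Q" for w
    using that by (simp add: add_eq square_def)
  define w where "w = x \<odot> y"
  have w: "w \<in> Q" "add x y = e \<odot> w" using assms by (simp_all add: w_def add_eq cl)
  have "add (add x y) (add z (add x y)) = add (add (add x y) (add x y)) z"
    using assms by (simp add: add_com[of z] add_add add_closed)
  also have "add (add x y) (add x y) = square w"
    using w by (simp add: dbl cl mult_mult_cancel flip: e_mult_square)
  \<comment> \<open>(Q2) with \<open>x\<close> and \<open>y\<close> exchanged, for the square of
    \<open>w\<close>, which is the double of \<open>add x y\<close>.\<close>
  also have "add (square w) z = e \<odot> (y \<odot> (square x \<odot> (y \<odot> z)))"
    using assms w by (simp add: add_eq cl Q2_eq commute[of y x] flip: w_def)
  also have "\<dots> = add y (add (add x x) (add y z))"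
    using assms by (simp add: dbl add_eq[of _ z] add_eq[of "e \<odot> _"] add_eq[of y] mult_mult_cancel cl flip: e_mult_mult)
  also have "\<dots> = add y (add x (add x (add y z)))" using assms by (simp add: add_add add_closed)
  finally show ?thesis using assms by (metis add_com add_closed)
qed

lemma commutative_RIF_loop_add: "commutative_RIF_loop Q add e"
proof -
  have ne: "add x (e \<odot> x) = e" "add (e \<odot> x) x = e" if "x \<in> Q" for x
    using neg_add_eq[of x e] that by (simp_all add: add_com[of x] add_e cl)
  have ex: "\<exists>x'\<in>Q. add x x' = e \<and> add x' x = e \<and> (\<forall>y\<in>Q. add x' (add x y) = y \<and> add (add y x) x' = y)"
    if "x \<in> Q" for x
  proof (intro bexI[of _ "e \<odot> x"] conjI ballI)
    fix y assume y: "y \<in> Q"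
    show "add (e \<odot> x) (add x y) = y" using that y by (rule neg_add_eq)
    then show "add (add y x) (e \<odot> x) = y" using that y by (metis add_com add_closed cl(1,3))
  qed (use that ne in \<open>auto simp: cl\<close>)
  have L: "IP_loop Q add e"
  proof unfold_locales
    fix a b assume ab: "a \<in> Q" "b \<in> Q"
    have inv: "add a (add (e \<odot> a) b) = b"
      using neg_add_eq[of "e \<odot> a" b] ab by (simp add: mult_mult_cancel cl)
    show "\<exists>!x. x \<in> Q \<and> add a x = b" using ab inv neg_add_eq add_closed cl by metis
    show "\<exists>!y. y \<in> Q \<and> add y a = b" using ab inv neg_add_eq add_closed cl add_com by metis
  qed (use ex in \<open>auto simp: add_closed add_com[of _ e] add_e e_closed\<close>)
  show ?thesis
    by (intro commutative_RIF_loop.intro RIF_loop.intro RIF_loop_axioms.intro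
        commutative_RIF_loop_axioms.intro L disjI2)
      (auto simp: IP_loop.RIF2_def[OF L] add_RIF intro: add_com)
qed

lemma has_exponent_6: "loop.has_exponent Q add e 6"
proof -
  have L: "loop Q add e"
    using commutative_RIF_loop_add
    by (simp add: commutative_RIF_loop_def RIF_loop_def IP_loop_def)
  show ?thesis unfolding loop.has_exponent_def[OF L]
  proof
    fix x assume x: "x \<in> Q"
    \<comment> \<open>Being the square of \<open>e \<odot> x\<close>, \<open>d\<close> is its own
      square by (Q1); hence 2d is \<open>e \<odot> d\<close>, the negative of \<open>d\<close>, and
      6x = 3d vanishes.\<close>
    define d where "d = add x x"
    have d: "d \<in> Q" "square d = d"
      using x by (simp_all add: d_def add_eq square_square e_mult_square cl flip: square_def)
    have "loop.multiple add e 6 x = add d (add d d)"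
      unfolding loop.multiple_def[OF L] using x d
      by (simp add: numeral_eq_Suc add_com[of _ e] add_e e_closed add_add add_closed flip: d_def)
    also have "add d d = e \<odot> d" using d by (simp add: add_eq flip: square_def)
    also have "add d (e \<odot> d) = e"
      using d by (simp add: add_eq commute[of e d] mult_mult_cancel e_idem cl)
    finally show "loop.multiple add e 6 x = e" .
  qed
qed

end

end

theorem theorem5p6:
  fixes Q :: "'a set"
  shows
    "(\<forall>add zero mult.
        commutative_RIF_loop Q add zero \<and> loop.has_exponent Q add zero 6 \<and>
        (\<forall>x\<in>Q. \<forall>y\<in>Q. mult x y = add (loop.neg Q add zero x) (loop.neg Q add zero y))
        \<longrightarrow> totally_symmetric_quasigroup Q mult \<and> quasigroup.Q1 Q mult \<and> quasigroup.Q2 Q mult)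
     \<and>
     (\<forall>mult zero add.
        totally_symmetric_quasigroup Q mult \<and> quasigroup.Q1 Q mult \<and> quasigroup.Q2 Q mult \<and>
        zero \<in> Q \<and> mult zero zero = zero \<and>
        (\<forall>x\<in>Q. \<forall>y\<in>Q. add x y = mult (mult zero x) (mult zero y))
        \<longrightarrow> commutative_RIF_loop Q add zero \<and> loop.has_exponent Q add zero 6)"
proof (intro conjI allI impI; elim conjE)
  fix add zero mult
  assume "commutative_RIF_loop Q add zero" and exp: "loop.has_exponent Q add zero 6"
    and m: "\<forall>x\<in>Q. \<forall>y\<in>Q. mult x y = add (loop.neg Q add zero x) (loop.neg Q add zero y)"
  then interpret commutative_RIF_loop Q add zero by simp
  show "totally_symmetric_quasigroup Q mult" using m by (intro TS_quasigroup_neg_add) blast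
  show "quasigroup.Q1 Q mult" "quasigroup.Q2 Q mult" using m exp by (intro Q1_Q2_neg_add; blast)+
next
  fix mult zero add
  assume "totally_symmetric_quasigroup Q mult" "quasigroup.Q1 Q mult" "quasigroup.Q2 Q mult"
    "zero \<in> Q" "mult zero zero = zero"
    and a: "\<forall>x\<in>Q. \<forall>y\<in>Q. add x y = mult (mult zero x) (mult zero y)"
  then interpret pointed_Q12_quasigroup Q mult zero
    by (simp add: pointed_Q12_quasigroup_def pointed_Q12_quasigroup_axioms_def)
  show "commutative_RIF_loop Q add zero" using a by (intro commutative_RIF_loop_add) blast
  show "loop.has_exponent Q add zero 6" using a by (intro has_exponent_6) blast
qed

end
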